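(* Let $\mathcal{I} = ((\mathcal{F}_i)_{i=1}^n,\pi)$ be an instance of the hiring problem, let $\mathrm{OPTOff}$ be the optimal offline algorithm (hiring a candidate of maximum value, so $\mathbb{E}[\mathrm{OPTOff}]=\mathbb{E}[\max_i X_i]$), and let $\mathrm{OPTOffIIF}$ be an optimal (expected-value-maximizing) offline IIF algorithm for $\mathcal{I}$. Then \[ \mathbb{E}[\mathrm{OPTOffIIF}] \ge \tfrac12\,\mathbb{E}[\mathrm{OPTOff}]. \]
   Context: Hiring problem: $n$ candidates; candidate $i$ has a nonnegative random value $X_i\sim\mathcal{F}_i$, the $X_i$ independent, each $\mathcal{F}_i$ discrete; $f_i(x)=\Pr[X_i=x]$, $\mathcal{S}=\bigcup_i\{x:f_i(x)>0\}$. An offline algorithm sees all of $X_1,\dots,X_n$ and then (possibly randomly) hires at most one candidate; its name also denotes the value of the hired candidate ($0$ if none). An algorithm is IIF with probability function $p:\mathcal{S}\to[0,1]$ if $\Pr[\mathrm{ALG}\text{ hires } i\mid X_i=x]=p(x)$ for all $i\in[n]$, $x\in\mathcal{S}$; IIF means IIF with some such $p$. *)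

theory Defs
  imports "HOL-Probability.Probability" "HOL-Combinatorics.Permutations"
begin

text \<open>The order \<open>\<pi>\<close> is the order of arrival; it is part of an instance, but offline algorithms
  do not depend on it.\<close>

definition hiring_instance :: "nat \<Rightarrow> (nat \<Rightarrow> real pmf) \<Rightarrow> (nat \<Rightarrow> nat) \<Rightarrow> bool" where
  "hiring_instance n F \<pi> \<longleftrightarrow>
     (\<forall>i\<in>{1..n}. \<forall>x\<in>set_pmf (F i). 0 \<le> x) \<and> \<pi> permutes {1..n}"

definition value_support :: "nat \<Rightarrow> (nat \<Rightarrow> real pmf) \<Rightarrow> real set" where
  "value_support n F = (\<Union>i\<in>{1..n}. {x. pmf (F i) x > 0})"

text \<open>Joint law of the independent values \<open>X\<^sub>1, \<dots>, X\<^sub>n\<close>; coordinates outside \<open>{1..n}\<close> are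
  the dummy value 0.\<close>

definition values_pmf :: "nat \<Rightarrow> (nat \<Rightarrow> real pmf) \<Rightarrow> (nat \<Rightarrow> real) pmf" where
  "values_pmf n F = Pi_pmf {1..n} 0 F"

text \<open>A randomized offline algorithm maps the realized values to the law of its decision:
  \<open>Some i\<close> hires candidate \<open>i\<close>, and \<open>None\<close> hires nobody.\<close>

type_synonym offline_alg = "(nat \<Rightarrow> real) \<Rightarrow> nat option pmf"

definition is_offline_alg :: "nat \<Rightarrow> (nat \<Rightarrow> real pmf) \<Rightarrow> offline_alg \<Rightarrow> bool" where
  "is_offline_alg n F A \<longleftrightarrow>
     (\<forall>v\<in>set_pmf (values_pmf n F). set_pmf (A v) \<subseteq> insert None (Some ` {1..n}))"

definition run :: "nat \<Rightarrow> (nat \<Rightarrow> real pmf) \<Rightarrow> offline_alg \<Rightarrow> ((nat \<Rightarrow> real) \<times> nat option) pmf" where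
  "run n F A = do { v \<leftarrow> values_pmf n F; h \<leftarrow> A v; return_pmf (v, h) }"

fun hired_value :: "(nat \<Rightarrow> real) \<times> nat option \<Rightarrow> real" where
  "hired_value (v, None) = 0"
| "hired_value (v, Some i) = v i"

text \<open>Values are nonnegative, so the expectation is taken in \<open>[0, \<infinity>]\<close>; no integrability
  assumption is needed.\<close>

definition expected_value :: "nat \<Rightarrow> (nat \<Rightarrow> real pmf) \<Rightarrow> offline_alg \<Rightarrow> ennreal" where
  "expected_value n F A = (\<integral>\<^sup>+\<omega>. ennreal (hired_value \<omega>) \<partial>measure_pmf (run n F A))"

text \<open>The conditional probability given \<open>X\<^sub>i = x\<close> is meaningful only if \<open>X\<^sub>i = x\<close> has positive
  probability. The library's conditional probability is 0 otherwise, so without the guard a value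
  outside the support of a single candidate would force \<open>p x = 0\<close>.\<close>

definition IIF_with :: "nat \<Rightarrow> (nat \<Rightarrow> real pmf) \<Rightarrow> offline_alg \<Rightarrow> (real \<Rightarrow> real) \<Rightarrow> bool" where
  "IIF_with n F A p \<longleftrightarrow>
     (\<forall>x\<in>value_support n F. p x \<in> {0..1}) \<and>
     (\<forall>i\<in>{1..n}. \<forall>x\<in>value_support n F. pmf (F i) x > 0 \<longrightarrow>
        \<P>(\<omega> in measure_pmf (run n F A). snd \<omega> = Some i \<bar> fst \<omega> i = x) = p x)"

definition IIF :: "nat \<Rightarrow> (nat \<Rightarrow> real pmf) \<Rightarrow> offline_alg \<Rightarrow> bool" where
  "IIF n F A \<longleftrightarrow> (\<exists>p. IIF_with n F A p)"

definition is_OPTOff :: "nat \<Rightarrow> (nat \<Rightarrow> real pmf) \<Rightarrow> offline_alg \<Rightarrow> bool" where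
  "is_OPTOff n F A \<longleftrightarrow>
     (\<forall>v\<in>set_pmf (values_pmf n F).
        set_pmf (A v) \<subseteq> Some ` {i\<in>{1..n}. \<forall>j\<in>{1..n}. v j \<le> v i})"

definition is_OPTOffIIF :: "nat \<Rightarrow> (nat \<Rightarrow> real pmf) \<Rightarrow> offline_alg \<Rightarrow> bool" where
  "is_OPTOffIIF n F A \<longleftrightarrow>
     is_offline_alg n F A \<and> IIF n F A \<and>
     (\<forall>B. is_offline_alg n F B \<and> IIF n F B \<longrightarrow> expected_value n F B \<le> expected_value n F A)"

lemma expected_value_OPTOff:
  assumes "is_OPTOff n F A"
  shows "expected_value n F A =
    (\<integral>\<^sup>+v. ennreal (Max (v ` {1..n})) \<partial>measure_pmf (values_pmf n F))"
proof -
  have *: "hired_value (v, h) = Max (v ` {1..n})"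
    if v: "v \<in> set_pmf (values_pmf n F)" "h \<in> set_pmf (A v)" for v h
  proof -
    obtain i where i: "h = Some i" "i \<in> {1..n}" "\<forall>j\<in>{1..n}. v j \<le> v i"
      using assms v unfolding is_OPTOff_def by blast
    have "Max (v ` {1..n}) = v i"
      by (rule Max_eqI) (use i in auto)
    then show ?thesis using i by simp
  qed
  have "expected_value n F A =
      (\<integral>\<^sup>+v. \<integral>\<^sup>+h. ennreal (hired_value (v, h)) \<partial>measure_pmf (A v) \<partial>measure_pmf (values_pmf n F))"
    by (simp add: expected_value_def run_def)
  also have "\<dots> = (\<integral>\<^sup>+v. \<integral>\<^sup>+h. ennreal (Max (v ` {1..n})) \<partial>measure_pmf (A v)
      \<partial>measure_pmf (values_pmf n F))"
    by (intro nn_integral_cong_AE AE_pmfI) (simp only: *)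
  finally show ?thesis by simp
qed

end

theory Submission imports Defs begin

text \<open>Let \<open>q(x) = Pr[max\<^sub>i X\<^sub>i = x] / (\<Sum>\<^sub>i f\<^sub>i(x))\<close>. The union bound gives \<open>q \<le> 1\<close>, and
  \<open>\<Sum>\<^sub>i E[q(X\<^sub>i)] = 1\<close>, so candidates that are active independently with probability \<open>q(X\<^sub>i)\<close>
  are one active candidate on average. Alaei's contention resolution scheme scans the candidates
  and hires each one, conditionally on being active, with probability exactly \<open>1/2\<close>. This is an
  IIF algorithm with \<open>p = q/2\<close>, and its value is
  \<open>\<Sum>\<^sub>x x p(x) (\<Sum>\<^sub>i f\<^sub>i(x)) = \<Sum>\<^sub>x x Pr[max\<^sub>i X\<^sub>i = x] / 2\<close>, half of the optimum.\<close>

section \<open>Hiring probabilities, expected value and the IIF condition\<close>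

text \<open>A joint rather than a conditional probability, so it makes sense also where
  \<open>pmf (F i) x = 0\<close>. Both the expected value and the IIF condition can be read off from
  it.\<close>

definition hire_prob :: "nat \<Rightarrow> (nat \<Rightarrow> real pmf) \<Rightarrow> offline_alg \<Rightarrow> nat \<Rightarrow> real \<Rightarrow> real" where
  "hire_prob n F A i x = measure (measure_pmf (run n F A)) {\<omega>. snd \<omega> = Some i \<and> fst \<omega> i = x}"

lemma map_values_pmf_component:
  assumes "i \<in> {1..n}"
  shows "map_pmf (\<lambda>v. v i) (values_pmf n F) = F i"
  using assms by (simp add: values_pmf_def Pi_pmf_component)

lemma map_fst_run: "map_pmf fst (run n F A) = values_pmf n F"
  by (simp add: run_def map_bind_pmf bind_return_pmf')

lemma measure_run_component:
  assumes "i \<in> {1..n}"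
  shows "measure (measure_pmf (run n F A)) {\<omega>. fst \<omega> i = x} = pmf (F i) x"
proof -
  have "F i = map_pmf (\<lambda>\<omega>. fst \<omega> i) (run n F A)"
    using map_values_pmf_component[OF assms, of F] map_fst_run[of n F A, symmetric]
    by (simp add: pmf.map_comp o_def)
  then have "pmf (F i) x = pmf (map_pmf (\<lambda>\<omega>. fst \<omega> i) (run n F A)) x" by simp
  then show ?thesis by (simp add: pmf_map vimage_def)
qed

lemma hire_prob_eq_expectation:
  "hire_prob n F A i x =
    measure_pmf.expectation (values_pmf n F) (\<lambda>v. if v i = x then pmf (A v) (Some i) else 0)"
proof -
  have "hire_prob n F A i x = pmf (map_pmf (\<lambda>\<omega>. (fst \<omega> i, snd \<omega> = Some i)) (run n F A)) (x, True)"
    by (auto simp: hire_prob_def pmf_map vimage_def intro!: arg_cong[where f = "measure _"])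
  also have "map_pmf (\<lambda>\<omega>. (fst \<omega> i, snd \<omega> = Some i)) (run n F A) =
      values_pmf n F \<bind> (\<lambda>v. map_pmf (\<lambda>h. (v i, h = Some i)) (A v))"
    by (simp add: run_def map_bind_pmf map_pmf_def bind_assoc_pmf bind_return_pmf)
  also have "pmf \<dots> (x, True) = measure_pmf.expectation (values_pmf n F)
      (\<lambda>v. if v i = x then pmf (A v) (Some i) else 0)"
    unfolding pmf_bind
  proof (rule Bochner_Integration.integral_cong)
    fix v
    have "(\<lambda>h. (v i, h = Some i)) -` {(x, True)} = (if v i = x then {Some i} else {})"
      by auto
    then show "pmf (map_pmf (\<lambda>h. (v i, h = Some i)) (A v)) (x, True) =
        (if v i = x then pmf (A v) (Some i) else 0)"
      by (simp add: pmf_map measure_pmf_single)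
  qed simp
  finally show ?thesis .
qed

lemma expected_value_eq_hire_prob:
  assumes "is_offline_alg n F A"
  shows "expected_value n F A =
    (\<Sum>i\<in>{1..n}. \<integral>\<^sup>+x. ennreal (hire_prob n F A i x) * ennreal x \<partial>count_space UNIV)"
proof -
  let ?R = "run n F A"
  \<comment> \<open>At most one summand is nonzero, and \<open>None\<close> gives the sum 0. That
    the hired index lies in \<open>{1..n}\<close> is the assumption on \<open>A\<close>.\<close>
  have "expected_value n F A =
      (\<integral>\<^sup>+\<omega>. (\<Sum>i\<in>{1..n}. ennreal (fst \<omega> i) * of_bool (snd \<omega> = Some i)) \<partial>measure_pmf ?R)"
    unfolding expected_value_def
  proof (intro nn_integral_cong_AE AE_pmfI)
    fix \<omega> assume "\<omega> \<in> set_pmf ?R"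
    then have "fst \<omega> \<in> set_pmf (values_pmf n F)" "snd \<omega> \<in> set_pmf (A (fst \<omega>))"
      by (auto simp: run_def)
    then have "snd \<omega> \<in> insert None (Some ` {1..n})"
      using assms unfolding is_offline_alg_def by blast
    then consider "snd \<omega> = None" | k where "k \<in> {1..n}" "snd \<omega> = Some k"
      by auto
    then show "ennreal (hired_value \<omega>) =
        (\<Sum>i\<in>{1..n}. ennreal (fst \<omega> i) * of_bool (snd \<omega> = Some i))"
    proof cases
      case 1
      then show ?thesis by (cases \<omega>) simp
    next
      case 2
      have "(\<Sum>i\<in>{1..n}. ennreal (fst \<omega> i) * of_bool (snd \<omega> = Some i)) =
          (\<Sum>i\<in>{1..n}. if k = i then ennreal (fst \<omega> i) else 0)"
        by (intro sum.cong) (auto simp: 2)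
      also have "\<dots> = ennreal (fst \<omega> k)"
        using 2 by (subst sum.delta') auto
      finally show ?thesis using 2 by (cases \<omega>) simp
    qed
  qed
  also have "\<dots> =
      (\<Sum>i\<in>{1..n}. \<integral>\<^sup>+\<omega>. ennreal (fst \<omega> i) * of_bool (snd \<omega> = Some i) \<partial>measure_pmf ?R)"
    by (intro nn_integral_sum) simp
  also have "\<dots> =
      (\<Sum>i\<in>{1..n}. \<integral>\<^sup>+x. ennreal (hire_prob n F A i x) * ennreal x \<partial>count_space UNIV)"
  proof (intro sum.cong refl)
    fix i
    \<comment> \<open>The summand of \<open>i\<close> depends only on the value of \<open>i\<close>
      and on whether \<open>i\<close> is hired. In the law of this pair only the part with
      \<open>True\<close> contributes, and that part is \<open>hire_prob\<close>.\<close>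
    let ?P = "map_pmf (\<lambda>\<omega>. (fst \<omega> i, snd \<omega> = Some i)) ?R"
    have hp: "pmf ?P (x, True) = hire_prob n F A i x" for x
      by (auto simp: hire_prob_def pmf_map vimage_def intro!: arg_cong[where f = "measure _"])
    have "(\<integral>\<^sup>+\<omega>. ennreal (fst \<omega> i) * of_bool (snd \<omega> = Some i) \<partial>measure_pmf ?R) =
        (\<integral>\<^sup>+z. ennreal (fst z) * of_bool (snd z) \<partial>measure_pmf ?P)"
      by simp
    also have "\<dots> = (\<integral>\<^sup>+z. ennreal (pmf ?P z) * (ennreal (fst z) * of_bool (snd z))
        \<partial>count_space UNIV)"
      by (rule nn_integral_measure_pmf)
    also have "\<dots> = (\<integral>\<^sup>+x. \<integral>\<^sup>+b. ennreal (pmf ?P (x, b)) * (ennreal x * of_bool b)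
        \<partial>count_space UNIV \<partial>count_space UNIV)"
      by (simp add: nn_integral_fst_count_space[symmetric])
    also have "\<dots> = (\<integral>\<^sup>+x. ennreal (hire_prob n F A i x) * ennreal x \<partial>count_space UNIV)"
      by (simp add: nn_integral_count_space_finite UNIV_bool hp)
    finally show "(\<integral>\<^sup>+\<omega>. ennreal (fst \<omega> i) * of_bool (snd \<omega> = Some i) \<partial>measure_pmf ?R) =
        (\<integral>\<^sup>+x. ennreal (hire_prob n F A i x) * ennreal x \<partial>count_space UNIV)" .
  qed
  finally show ?thesis .
qed

text \<open>Dividing by \<open>pmf (F i) x\<close>, the probability of the conditioning event, turns
  the product form into the conditional probability of \<open>IIF_with\<close>.\<close>

lemma IIF_withI:
  assumes "\<And>x. p x \<in> {0..1}"
    and "\<And>i x. i \<in> {1..n} \<Longrightarrow> hire_prob n F A i x = pmf (F i) x * p x"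
  shows "IIF_with n F A p"
  unfolding IIF_with_def
proof (intro conjI ballI impI)
  fix i x assume "i \<in> {1..n}" "pmf (F i) x > 0"
  then show "\<P>(\<omega> in measure_pmf (run n F A). snd \<omega> = Some i \<bar> fst \<omega> i = x) = p x"
    using assms(2)[of i x] measure_run_component[of i n F A x]
    by (simp add: cond_prob_def hire_prob_def)
qed (use assms(1) in auto)

section \<open>Contention resolution by a sequential scan\<close>

text \<open>Round \<open>j\<close> reads only coordinate \<open>j\<close> of \<open>v\<close>, which
  lets the hiring probabilities factor. Scanning by index is legitimate offline, whatever the order
  of arrival.\<close>

primrec scan :: "(nat \<Rightarrow> real \<Rightarrow> real) \<Rightarrow> nat \<Rightarrow> offline_alg" where
  "scan c 0 v = return_pmf None"
| "scan c (Suc k) v = scan c k v \<bind> (\<lambda>h. if h = None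
     then map_pmf (\<lambda>b. if b then Some (Suc k) else None) (bernoulli_pmf (c (Suc k) (v (Suc k))))
     else return_pmf h)"

lemma set_pmf_scan: "set_pmf (scan c k v) \<subseteq> insert None (Some ` {1..k})"
proof (induction k)
  case (Suc k)
  have "{1..k} \<subseteq> {1..Suc k}" by auto
  then have "set_pmf (scan c k v) \<subseteq> insert None (Some ` {1..Suc k})"
    using Suc by blast
  then show ?case by (auto split: if_splits)
qed simp

lemma pmf_scan_None:
  assumes "\<And>j x. 0 \<le> c j x" "\<And>j x. c j x \<le> 1"
  shows "pmf (scan c k v) None = (\<Prod>j\<in>{1..k}. 1 - c j (v j))"
proof (induction k)
  case (Suc k)
  let ?b = "c (Suc k) (v (Suc k))"
  have vim: "(\<lambda>b. if b then Some (Suc k) else None) -` {None} = {False}"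
    by (auto split: if_splits)
  have "pmf (scan c (Suc k) v) None =
      measure_pmf.expectation (scan c k v) (\<lambda>h. indicator {None} h * (1 - ?b))"
    unfolding scan.simps pmf_bind
    by (intro Bochner_Integration.integral_cong)
       (auto simp: pmf_map vim measure_pmf_single assms)
  also have "\<dots> = pmf (scan c k v) None * (1 - ?b)"
    by (simp add: measure_pmf_single)
  finally show ?case using Suc by (simp add: mult.commute)
qed simp

text \<open>Candidate \<open>i\<close> is hired exactly when all earlier coins fail and its own
  succeeds; later rounds keep the hire. The bounds on \<open>c\<close> matter because
  \<open>bernoulli_pmf\<close> truncates its parameter to the unit interval.\<close>

lemma pmf_scan_Some:
  assumes "\<And>j x. 0 \<le> c j x" "\<And>j x. c j x \<le> 1" "i \<in> {1..k}"
  shows "pmf (scan c k v) (Some i) = c i (v i) * (\<Prod>j\<in>{1..<i}. 1 - c j (v j))"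
  using assms(3)
proof (induction k)
  case (Suc k)
  let ?b = "c (Suc k) (v (Suc k))"
  show ?case
  proof (cases "i = Suc k")
    case True
    have vim: "(\<lambda>b. if b then Some (Suc k) else None) -` {Some (Suc k)} = {True}"
      by (auto split: if_splits)
    have "pmf (scan c (Suc k) v) (Some i) =
        measure_pmf.expectation (scan c k v) (\<lambda>h. indicator {None} h * ?b)"
      unfolding scan.simps pmf_bind
    \<comment> \<open>The integrands differ at \<open>h = Some (Suc k)\<close>, where
      \<open>return_pmf h\<close> would count as a hire; this \<open>h\<close> lies outside the
      support of the first \<open>k\<close> rounds.\<close>
    proof (intro integral_cong_AE AE_pmfI)
      fix h assume "h \<in> set_pmf (scan c k v)"
      then have "h \<noteq> Some (Suc k)"
        using set_pmf_scan[of c k v] by auto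
      then show "pmf (if h = None then map_pmf (\<lambda>b. if b then Some (Suc k) else None)
          (bernoulli_pmf ?b) else return_pmf h) (Some i) = indicator {None} h * ?b"
        by (auto simp: True pmf_map vim measure_pmf_single assms)
    qed auto
    also have "\<dots> = pmf (scan c k v) None * ?b"
      by (simp add: measure_pmf_single)
    finally show ?thesis
      by (simp add: True pmf_scan_None assms(1,2) atLeastLessThanSuc_atLeastAtMost)
  next
    case False
    have vim: "(\<lambda>b. if b then Some (Suc k) else None) -` {Some i} = {}"
      using False by (auto split: if_splits)
    have "pmf (scan c (Suc k) v) (Some i) =
        measure_pmf.expectation (scan c k v) (\<lambda>h. indicator {Some i} h)"
      unfolding scan.simps pmf_bind
      by (intro Bochner_Integration.integral_cong)
         (auto simp: pmf_map vim indicator_def)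
    also have "\<dots> = pmf (scan c k v) (Some i)"
      by (simp add: measure_pmf_single)
    finally show ?thesis using Suc False by simp
  qed
qed simp

text \<open>Whether the scan reaches \<open>i\<close> depends on the coins and values of earlier
  candidates only, hence is independent of the value of \<open>i\<close>.\<close>

lemma hire_prob_scan:
  assumes c: "\<And>j x. 0 \<le> c j x" "\<And>j x. c j x \<le> 1" and i: "i \<in> {1..n}"
  shows "hire_prob n F (scan c n) i x =
    pmf (F i) x * c i x * (\<Prod>j\<in>{1..<i}. 1 - measure_pmf.expectation (F j) (c j))"
proof -
  \<comment> \<open>One factor per coordinate: failure before \<open>i\<close>, the event and the
    coin at \<open>i\<close>, and 1 afterwards. Independence then turns the expectation of the
    product into a product of expectations.\<close>
  define g where "g j y = (if j < i then 1 - c j y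
      else if j = i then indicator {x} y * c i x else 1)" for j and y :: real
  have split: "(\<Prod>j\<in>{1..n}. h j) = (\<Prod>j\<in>{1..<i}. h j) * h i * (\<Prod>j\<in>{i<..n}. h j)"
    for h :: "nat \<Rightarrow> real"
  proof -
    have "{1..n} = insert i ({1..<i} \<union> {i<..n})" using i by auto
    moreover have "prod h ({1..<i} \<union> {i<..n}) = prod h {1..<i} * prod h {i<..n}"
      by (rule prod.union_disjoint) auto
    ultimately show ?thesis by (simp add: mult_ac)
  qed
  have int: "integrable (measure_pmf (F j)) (c j)" for j
    by (rule measure_pmf.integrable_const_bound[where B = 1]) (use c in auto)
  have "hire_prob n F (scan c n) i x =
      measure_pmf.expectation (values_pmf n F) (\<lambda>v. \<Prod>j\<in>{1..n}. g j (v j))"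
    unfolding hire_prob_eq_expectation split pmf_scan_Some[OF c i]
    by (intro Bochner_Integration.integral_cong) (auto simp: g_def)
  also have "\<dots> = (\<Prod>j\<in>{1..n}. measure_pmf.expectation (F j) (g j))"
    unfolding values_pmf_def
  proof (rule expectation_prod_Pi_pmf)
    fix j
    have bd: "0 \<le> g j y" "g j y \<le> 1" for y
      using c by (auto simp: g_def indicator_def)
    show "integrable (measure_pmf (F j)) (g j)"
      by (rule measure_pmf.integrable_const_bound[where B = 1]) (use bd in auto)
    show "0 \<le> g j y" for y by (rule bd)
  qed simp
  also have "\<dots> = (\<Prod>j\<in>{1..<i}. 1 - measure_pmf.expectation (F j) (c j)) * (pmf (F i) x * c i x)"
  proof -
    have "measure_pmf.expectation (F j) (g j) = 1 - measure_pmf.expectation (F j) (c j)"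
      if "j < i" for j
      using that by (simp add: g_def[abs_def] int Bochner_Integration.integral_diff)
    moreover have "measure_pmf.expectation (F j) (g j) = 1" if "j > i" for j
      using that by (simp add: g_def[abs_def])
    moreover have "measure_pmf.expectation (F i) (g i) = pmf (F i) x * c i x"
      by (simp add: g_def[abs_def] measure_pmf_single)
    ultimately show ?thesis
      unfolding split by simp
  qed
  finally show ?thesis by (simp add: mult_ac)
qed

text \<open>If every earlier candidate \<open>j\<close> is hired with probability
  \<open>r j / 2\<close>, the scan reaches \<open>i\<close> with probability \<open>free i\<close>.
  A coin of bias \<open>q x / (2 * free i)\<close> cancels this factor and leaves
  \<open>q x / 2\<close>.\<close>

theorem half_contention_resolution:
  assumes q: "\<And>x. 0 \<le> q x" "\<And>x. q x \<le> 1"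
    and sum_le: "(\<Sum>j\<in>{1..n}. measure_pmf.expectation (F j) q) \<le> 1"
  obtains A where "is_offline_alg n F A"
    and "\<And>i x. i \<in> {1..n} \<Longrightarrow> hire_prob n F A i x = pmf (F i) x * (q x / 2)"
proof -
  define r where "r j = measure_pmf.expectation (F j) q" for j
  have r0: "0 \<le> r j" for j
    unfolding r_def using q by simp
  \<comment> \<open>the probability that nobody is hired before candidate \<open>i\<close>\<close>
  define free where "free i = 1 - (\<Sum>j\<in>{1..<i}. r j) / 2" for i
  \<comment> \<open>The only use of \<open>sum_le\<close>: it keeps the denominator
    \<open>2 * free j\<close> at least 1, so the biases are probabilities.\<close>
  have free_ge: "free i \<ge> 1 / 2" if "i \<le> Suc n" for i
  proof -
    have "(\<Sum>j\<in>{1..<i}. r j) \<le> (\<Sum>j\<in>{1..n}. r j)"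
      using that by (intro sum_mono2) (auto simp: r0)
    then show ?thesis using sum_le by (simp add: free_def r_def)
  qed
  \<comment> \<open>The coin merges being active (\<open>q x\<close>) with being accepted when
    active (\<open>1 / (2 * free j)\<close>). The value 0 outside \<open>{1..n}\<close> gives the
    bounds for all \<open>j\<close>, as the scan lemmas require.\<close>
  define c where "c j x = (if j \<in> {1..n} then q x / (2 * free j) else 0)" for j x
  have c: "0 \<le> c j x" "c j x \<le> 1" for j x
  proof -
    have "1 \<le> 2 * free j" if "j \<in> {1..n}" using free_ge[of j] that by simp
    then show "0 \<le> c j x" "c j x \<le> 1"
      using q[of x] by (auto simp: c_def divide_le_eq)
  qed
  \<comment> \<open>The sum defining \<open>free\<close> agrees with the product of failure
    probabilities in \<open>hire_prob_scan\<close>, since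
    \<open>free i * (1 - r i / (2 * free i)) = free i - r i / 2\<close>.\<close>
  have prod_free: "(\<Prod>j\<in>{1..<i}. 1 - measure_pmf.expectation (F j) (c j)) = free i"
    if "i \<le> Suc n" for i
    using that
  proof (induction i)
    case (Suc i)
    show ?case
    proof (cases "i = 0")
      case False
      then have i: "i \<in> {1..n}" using Suc.prems by simp
      have "measure_pmf.expectation (F i) (c i) = r i / (2 * free i)"
        using i by (simp add: c_def[abs_def] r_def)
      moreover have "free (Suc i) = free i - r i / 2"
        using i by (simp add: free_def field_simps)
      moreover have "free i \<noteq> 0" using free_ge[of i] i by auto
      ultimately show ?thesis
        using Suc i by (simp add: field_simps)
    qed (simp add: free_def)
  qed (simp add: free_def)
  show thesis
  proof
    show "is_offline_alg n F (scan c n)"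
      using set_pmf_scan by (auto simp: is_offline_alg_def)
    show "hire_prob n F (scan c n) i x = pmf (F i) x * (q x / 2)" if i: "i \<in> {1..n}" for i x
    proof -
      have "free i \<noteq> 0" using free_ge[of i] i by auto
      then show ?thesis
        using i prod_free[of i] unfolding hire_prob_scan[OF c i] by (auto simp: c_def[of i x])
    qed
  qed
qed

section \<open>The law of the maximum and an IIF algorithm worth half the optimum\<close>

definition max_pmf :: "nat \<Rightarrow> (nat \<Rightarrow> real pmf) \<Rightarrow> real pmf" where
  "max_pmf n F = map_pmf (\<lambda>v. Max (v ` {1..n})) (values_pmf n F)"

text \<open>Some candidate attains the maximum, as \<open>n \<ge> 1\<close>; then apply the union
  bound. Ties can make the inequality strict.\<close>

lemma pmf_max_le_sum:
  assumes "n \<ge> 1"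
  shows "pmf (max_pmf n F) x \<le> (\<Sum>i\<in>{1..n}. pmf (F i) x)"
proof -
  let ?V = "measure_pmf (values_pmf n F)"
  have "pmf (max_pmf n F) x = measure ?V {v. Max (v ` {1..n}) = x}"
    by (simp add: max_pmf_def pmf_map vimage_def)
  also have "\<dots> \<le> measure ?V (\<Union>i\<in>{1..n}. {v. v i = x})"
  proof (rule measure_pmf.finite_measure_mono)
    show "{v. Max (v ` {1..n}) = x} \<subseteq> (\<Union>i\<in>{1..n}. {v. v i = x})"
    proof
      fix v :: "nat \<Rightarrow> real" assume "v \<in> {v. Max (v ` {1..n}) = x}"
      moreover have "Max (v ` {1..n}) \<in> v ` {1..n}"
        using assms by (intro Max_in) auto
      ultimately show "v \<in> (\<Union>i\<in>{1..n}. {v. v i = x})" by auto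
    qed
  qed simp
  also have "\<dots> \<le> (\<Sum>i\<in>{1..n}. measure ?V {v. v i = x})"
    by (intro measure_pmf.finite_measure_subadditive_finite) auto
  also have "\<dots> = (\<Sum>i\<in>{1..n}. pmf (F i) x)"
  proof (intro sum.cong refl)
    fix i assume "i \<in> {1..n}"
    then have "pmf (F i) x = pmf (map_pmf (\<lambda>v. v i) (values_pmf n F)) x"
      by (simp add: map_values_pmf_component)
    then show "measure ?V {v. v i = x} = pmf (F i) x"
      by (simp add: pmf_map vimage_def)
  qed
  finally show ?thesis .
qed

theorem exists_half_optimal_IIF:
  assumes n: "n \<ge> 1"
  obtains A where "is_offline_alg n F A" "IIF n F A"
    "expected_value n F A = 1 / 2 * (\<integral>\<^sup>+x. ennreal x \<partial>measure_pmf (max_pmf n F))"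
proof -
  define f where "f x = (\<Sum>i\<in>{1..n}. pmf (F i) x)" for x
  \<comment> \<open>Not depending on the candidate, \<open>q\<close> can serve as an IIF probability
    function. Where \<open>f x = 0\<close>, division yields 0, which is harmless:
    \<open>max_le\<close> makes \<open>pmf (max_pmf n F) x\<close> vanish there too.\<close>
  define q where "q x = pmf (max_pmf n F) x / f x" for x
  have f0: "0 \<le> f x" for x
    by (simp add: f_def sum_nonneg)
  have max_le: "pmf (max_pmf n F) x \<le> f x" for x
    unfolding f_def by (rule pmf_max_le_sum[OF n])
  have q: "0 \<le> q x" "q x \<le> 1" for x
    using f0[of x] max_le[of x] by (auto simp: q_def divide_le_eq)
  have fq: "f x * q x = pmf (max_pmf n F) x" for x
    using max_le[of x] f0[of x] pmf_nonneg[of "max_pmf n F" x] by (auto simp: q_def)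
  have fq': "(\<Sum>i\<in>{1..n}. ennreal (pmf (F i) x * q x)) = ennreal (pmf (max_pmf n F) x)" for x
    using q[of x] by (simp add: fq[symmetric] f_def sum_distrib_right)
  \<comment> \<open>Exchanging the sums over candidates and values turns the expected number of
    active candidates into the total mass of the law of the maximum.\<close>
  have "ennreal (\<Sum>j\<in>{1..n}. measure_pmf.expectation (F j) q) =
      (\<Sum>j\<in>{1..n}. \<integral>\<^sup>+x. ennreal (q x) \<partial>measure_pmf (F j))"
  proof -
    have "integrable (measure_pmf (F j)) q" for j
      by (rule measure_pmf.integrable_const_bound[where B = 1]) (use q in auto)
    then show ?thesis
      using q by (simp add: nn_integral_eq_integral)
  qed
  also have "\<dots> = (\<Sum>j\<in>{1..n}. \<integral>\<^sup>+x. ennreal (pmf (F j) x * q x) \<partial>count_space UNIV)"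
    by (simp add: nn_integral_measure_pmf ennreal_mult' q)
  also have "\<dots> = (\<integral>\<^sup>+x. ennreal (pmf (max_pmf n F) x) \<partial>count_space UNIV)"
    by (subst nn_integral_sum[symmetric]) (simp_all only: fq' borel_measurable_count_space)
  also have "\<dots> = 1"
    by (simp add: nn_integral_pmf measure_pmf.emeasure_space_1[simplified])
  finally have "(\<Sum>j\<in>{1..n}. measure_pmf.expectation (F j) q) \<le> 1"
    by simp
  then obtain A where A: "is_offline_alg n F A"
      "\<And>i x. i \<in> {1..n} \<Longrightarrow> hire_prob n F A i x = pmf (F i) x * (q x / 2)"
    using half_contention_resolution[of q F n] q by blast
  have "IIF_with n F A (\<lambda>x. q x / 2)"
  proof (rule IIF_withI)
    show "q x / 2 \<in> {0..1}" for x using q[of x] by simp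
  qed (rule A(2))
  then have IIF: "IIF n F A" unfolding IIF_def by blast
  have half: "ennreal (y / 2) = 1 / 2 * ennreal y" if "0 \<le> y" for y
    using that by (simp add: divide_ennreal[symmetric] ennreal_divide_times)
  have "expected_value n F A =
      (\<Sum>i\<in>{1..n}. \<integral>\<^sup>+x. 1 / 2 * ennreal (pmf (F i) x * q x) * ennreal x \<partial>count_space UNIV)"
    unfolding expected_value_eq_hire_prob[OF A(1)]
    by (intro sum.cong nn_integral_cong refl) (simp add: A(2) q flip: half)
  also have "\<dots> = (\<integral>\<^sup>+x. (\<Sum>i\<in>{1..n}. 1 / 2 * ennreal (pmf (F i) x * q x) * ennreal x)
      \<partial>count_space UNIV)"
    by (rule nn_integral_sum[symmetric]) simp
  also have "\<dots> = (\<integral>\<^sup>+x. 1 / 2 * (ennreal (pmf (max_pmf n F) x) * ennreal x) \<partial>count_space UNIV)"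
    by (simp only: sum_distrib_left[symmetric] sum_distrib_right[symmetric] fq' mult.assoc)
  also have "\<dots> = 1 / 2 * (\<integral>\<^sup>+x. ennreal x \<partial>measure_pmf (max_pmf n F))"
    by (simp add: nn_integral_cmult nn_integral_measure_pmf)
  finally show thesis using that A(1) IIF by blast
qed

theorem mainTheorem12:
  fixes n :: nat and F :: "nat \<Rightarrow> real pmf" and \<pi> :: "nat \<Rightarrow> nat"
    and OPTOff OPTOffIIF :: offline_alg
  assumes "hiring_instance n F \<pi>"
    and "is_OPTOff n F OPTOff"
    and "is_OPTOffIIF n F OPTOffIIF"
  shows "expected_value n F OPTOffIIF \<ge> 1 / 2 * expected_value n F OPTOff"
proof -
  \<comment> \<open>With no candidates the set of maximizers is empty, but the law of the decision
    of \<open>OPTOff\<close> has nonempty support.\<close>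
  have "n \<ge> 1"
  proof (rule ccontr)
    assume "\<not> n \<ge> 1"
    moreover obtain v where "v \<in> set_pmf (values_pmf n F)"
      using set_pmf_not_empty[of "values_pmf n F"] by blast
    ultimately have "set_pmf (OPTOff v) \<subseteq> {}"
      using assms(2) unfolding is_OPTOff_def by fastforce
    then show False using set_pmf_not_empty[of "OPTOff v"] by blast
  qed
  then obtain A where A: "is_offline_alg n F A" "IIF n F A"
      "expected_value n F A = 1 / 2 * (\<integral>\<^sup>+x. ennreal x \<partial>measure_pmf (max_pmf n F))"
    by (rule exists_half_optimal_IIF)
  have "1 / 2 * expected_value n F OPTOff = expected_value n F A"
    unfolding A(3) expected_value_OPTOff[OF assms(2)] by (simp add: max_pmf_def)
  also have "\<dots> \<le> expected_value n F OPTOffIIF"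
    using assms(3) A(1,2) unfolding is_OPTOffIIF_def by blast
  finally show ?thesis .
qed

end
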